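(* Let $n>1$ and let $\kappa=(\kappa_1,\dots,\kappa_n)$ be real numbers with $0<\kappa_i<2\pi$ for all $1\le i\le n$. Then the signature of the area Hermitian form $h_A$ on $\mathfrak{P}(\kappa)$ is $(p(\kappa),q(\kappa))$. Moreover, $$q(\kappa)=n-1-\left\lfloor \sum_{k=1}^n\frac{\kappa_k}{2\pi}\right\rfloor$$ and $$p(\kappa)=\left\lfloor \sum_{k=1}^n\frac{\kappa_k}{2\pi}\right\rfloor-\epsilon(\kappa).$$
   Context: Write $\imath=\sqrt{-1}$. For $\kappa=(\kappa_1,\dots,\kappa_n)$ with $n>1$ and $0<\kappa_i<2\pi$, let $\mathfrak{P}(\kappa)$ be the complex vector space $$\mathfrak{P}(\kappa)=\{\hat z=(z_1,\dots,z_{2n})\in\mathbb{C}^{2n}: z_1=0,\ e^{\imath\kappa_i}(z_{2i-1}-z_{2i})=z_{2i+1}-z_{2i},\ 1\le i\le n\},$$ with the convention $z_{2n+1}=z_1$. It has complex dimension $n-1$. The area Hermitian form on $\mathfrak{P}(\kappa)$ is $$h_A(\hat z,\hat w)=\frac{\sqrt{-1}}{4}\sum_{i=1}^{2n-1}(z_i\overline{w}_{i+1}-z_{i+1}\overline{w}_i).$$ The signature of a Hermitian form $h$ on a finite-dimensional complex vector space is the pair $(P(h),N(h))$, where, in any basis $\{u_j\}$ diagonalizing $h$ with $h(u_j,u_j)\in\{1,-1,0\}$, $P(h)$ is the number of $j$ with $h(u_j,u_j)=1$ and $N(h)$ is the number of $j$ with $h(u_j,u_j)=-1$ (the form may be degenerate).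 Define $\epsilon(\kappa)=1$ if $\sum_{i=1}^n\kappa_i\in 2\pi\mathbb{Z}$ and $\epsilon(\kappa)=0$ otherwise; $$q(\kappa)=\left|\left\{i: 1\le i<n,\ \left\lfloor\sum_{k=1}^{i+1}\frac{\kappa_k}{2\pi}\right\rfloor=\left\lfloor\sum_{k=1}^{i}\frac{\kappa_k}{2\pi}\right\rfloor\right\}\right|,\qquad p(\kappa)=n-1-q(\kappa)-\epsilon(\kappa).$$ *)

theory Defs
  imports Complex_Main "HOL-Library.Function_Algebras"
begin

definition cscale :: "complex \<Rightarrow> (nat \<Rightarrow> complex) \<Rightarrow> nat \<Rightarrow> complex" where
  "cscale c z = (\<lambda>j. c * z j)"

global_interpretation cvec: vector_space cscale
  by unfold_locales (auto simp: cscale_def fun_eq_iff algebra_simps)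

definition hermitian_form_on ::
  "(nat \<Rightarrow> complex) set \<Rightarrow> ((nat \<Rightarrow> complex) \<Rightarrow> (nat \<Rightarrow> complex) \<Rightarrow> complex) \<Rightarrow> bool" where
  "hermitian_form_on V h \<longleftrightarrow>
     (\<forall>u\<in>V. \<forall>v\<in>V. \<forall>w\<in>V. h (u + v) w = h u w + h v w) \<and>
     (\<forall>c. \<forall>u\<in>V. \<forall>w\<in>V. h (cscale c u) w = c * h u w) \<and>
     (\<forall>u\<in>V. \<forall>w\<in>V. h w u = cnj (h u w))"

definition normalized_diagonal_basis ::
  "(nat \<Rightarrow> complex) set \<Rightarrow> ((nat \<Rightarrow> complex) \<Rightarrow> (nat \<Rightarrow> complex) \<Rightarrow> complex) \<Rightarrow>
   (nat \<Rightarrow> complex) set \<Rightarrow> bool" where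
  "normalized_diagonal_basis V h B \<longleftrightarrow>
     finite B \<and> cvec.independent B \<and> cvec.span B = V \<and>
     (\<forall>u\<in>B. \<forall>v\<in>B. u \<noteq> v \<longrightarrow> h u v = 0) \<and>
     (\<forall>u\<in>B. h u u \<in> {1, -1, 0})"

text \<open>The signature counts are required to be the same in every normalized diagonalizing
  basis; that such a basis exists is part of the definition, so that it never holds vacuously.
  Existence of a finite basis also makes \<open>V\<close> a finite-dimensional subspace.\<close>

definition has_signature ::
  "(nat \<Rightarrow> complex) set \<Rightarrow> ((nat \<Rightarrow> complex) \<Rightarrow> (nat \<Rightarrow> complex) \<Rightarrow> complex) \<Rightarrow>
   int \<times> int \<Rightarrow> bool" where
  "has_signature V h s \<longleftrightarrow>
     hermitian_form_on V h \<and>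
     (\<exists>B. normalized_diagonal_basis V h B) \<and>
     (\<forall>B. normalized_diagonal_basis V h B \<longrightarrow>
        s = (int (card {u \<in> B. h u u = 1}), int (card {u \<in> B. h u u = -1})))"

text \<open>A point \<open>(z 1, \<dots>, z (2n))\<close> of \<open>2n\<close>-dimensional complex space is encoded as a sequence that
  vanishes outside the indices \<open>{1..2n}\<close>. The case distinction is the cyclic convention
  \<open>z (2n + 1) = z 1\<close>.\<close>

definition polygon_space :: "nat \<Rightarrow> (nat \<Rightarrow> real) \<Rightarrow> (nat \<Rightarrow> complex) set" where
  "polygon_space n \<kappa> =
     {z. (\<forall>j. j \<notin> {1..2 * n} \<longrightarrow> z j = 0) \<and> z 1 = 0 \<and>
         (\<forall>i\<in>{1..n}. exp (\<i> * complex_of_real (\<kappa> i)) * (z (2 * i - 1) - z (2 * i)) =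
            (if i = n then z 1 else z (2 * i + 1)) - z (2 * i))}"

definition area_form :: "nat \<Rightarrow> (nat \<Rightarrow> complex) \<Rightarrow> (nat \<Rightarrow> complex) \<Rightarrow> complex" where
  "area_form n z w =
     \<i> / 4 * (\<Sum>i = 1..2 * n - 1. z i * cnj (w (i + 1)) - z (i + 1) * cnj (w i))"

definition eps_kappa :: "nat \<Rightarrow> (nat \<Rightarrow> real) \<Rightarrow> int" where
  "eps_kappa n \<kappa> = (if \<exists>m::int. (\<Sum>i = 1..n. \<kappa> i) = 2 * pi * of_int m then 1 else 0)"

definition q_kappa :: "nat \<Rightarrow> (nat \<Rightarrow> real) \<Rightarrow> int" where
  "q_kappa n \<kappa> =
     int (card {i \<in> {1..<n}. \<lfloor>\<Sum>k = 1..i + 1. \<kappa> k / (2 * pi)\<rfloor> = \<lfloor>\<Sum>k = 1..i. \<kappa> k / (2 * pi)\<rfloor>})"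

definition p_kappa :: "nat \<Rightarrow> (nat \<Rightarrow> real) \<Rightarrow> int" where
  "p_kappa n \<kappa> = int n - 1 - q_kappa n \<kappa> - eps_kappa n \<kappa>"

end

theory Submission
  imports Defs
begin

text \<open>An element of \<open>polygon_space n \<kappa>\<close> is determined by its odd-indexed vertices, since every
  even-indexed vertex is the apex of an isosceles triangle with prescribed apex angle. In these
  coordinates the area form is tridiagonal. Let \<open>S\<^sub>k\<close> be the sum of the first \<open>k\<close> angles. Polygons
  whose triangles share one apex give vectors \<open>v\<^sub>k\<close>, each orthogonal to the first \<open>k - 1\<close> coordinate
  vectors, with \<open>h(v\<^sub>k, v\<^sub>k) = - sin (S\<^sub>k / 2) sin (S\<^sub>k\<^sub>+\<^sub>1 / 2) / sin (\<kappa>\<^sub>k\<^sub>+\<^sub>1 / 2)\<close>: this is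
  negative exactly if \<open>S / 2\<pi>\<close> does not cross or reach an integer. They diagonalize the form as long
  as \<open>S\<^sub>k\<close> is not a multiple of \<open>2\<pi>\<close>. If it is, \<open>v\<^sub>k\<close> no longer involves the \<open>k\<close>-th coordinate, and
  \<open>v\<^sub>k\<^sub>-\<^sub>1\<close> is isotropic and spans with the \<open>k\<close>-th coordinate vector a hyperbolic plane, which
  contributes one positive and one negative direction.\<close>

section \<open>Signatures of Hermitian forms\<close>

text \<open>Otherwise the simplifier turns sums of vectors under a form into pointwise abstractions.\<close>

declare plus_fun_apply [simp del] zero_fun_apply [simp del]

text \<open>Turns trivially intersecting spans into a bound on cardinalities, the dimension count
  behind Sylvester's law.\<close>

lemma cvec_independent_Un:
  assumes "finite T" "cvec.independent S" "cvec.independent T"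
    and "cvec.span S \<inter> cvec.span T \<subseteq> {0}"
  shows "cvec.independent (S \<union> T)"
  using assms
proof (induction T)
  case (insert a T)
  have T: "cvec.independent T" "a \<notin> cvec.span T"
    using insert by (auto simp: cvec.independent_insert)
  have "a \<notin> cvec.span (S \<union> T)"
  proof
    assume "a \<in> cvec.span (S \<union> T)"
    then obtain s t where st: "s \<in> cvec.span S" "t \<in> cvec.span T" "a = s + t"
      by (auto simp: cvec.span_Un)
    have "t \<in> cvec.span (insert a T)"
      using st(2) cvec.span_mono[of T "insert a T"] by blast
    then have "a - t \<in> cvec.span (insert a T)"
      using cvec.span_diff[OF cvec.span_base] by blast
    moreover have "a - t = s"
      using st(3) by simp
    ultimately have "s = 0"
      using st(1) insert.prems(3) by blast
    then have "a = t"
      using st(3) by simp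
    then show False
      using st T by simp
  qed
  moreover have "cvec.span S \<inter> cvec.span T \<subseteq> {0}"
    using insert.prems(3) cvec.span_mono[of T "insert a T"] by blast
  then have "cvec.independent (S \<union> T)"
    using insert T by blast
  ultimately show ?case
    by (simp add: cvec.independent_insertI)
qed simp

text \<open>Asks for one basis only, which is what an inductive construction can deliver; the law of
  inertia later upgrades it to \<open>has_signature\<close>.\<close>

definition diagonal_counts ::
  "(nat \<Rightarrow> complex) set \<Rightarrow> ((nat \<Rightarrow> complex) \<Rightarrow> (nat \<Rightarrow> complex) \<Rightarrow> complex) \<Rightarrow> nat \<Rightarrow> nat \<Rightarrow> bool" where
  "diagonal_counts V h p q \<longleftrightarrow> (\<exists>B. normalized_diagonal_basis V h B \<and>
     card {u \<in> B. h u u = 1} = p \<and> card {u \<in> B. h u u = -1} = q)"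

text \<open>The laws are imposed on all sequences, so the form restricts to any span without
  membership conditions.\<close>

locale hermitian_form =
  fixes h :: "(nat \<Rightarrow> complex) \<Rightarrow> (nat \<Rightarrow> complex) \<Rightarrow> complex"
  assumes add_left: "h (u + v) w = h u w + h v w"
    and scale_left: "h (cscale c u) w = c * h u w"
    and hermitian: "h w u = cnj (h u w)"
begin

lemma hermitian_form_on: "hermitian_form_on V h"
  unfolding hermitian_form_on_def using add_left scale_left hermitian by blast

lemma hermitian_form_uminus: "hermitian_form (\<lambda>u v. - h u v)"
  by unfold_locales (simp_all add: add_left scale_left hermitian[symmetric])

lemma add_right: "h w (u + v) = h w u + h w v"
  by (metis add_left hermitian complex_cnj_add)

lemma scale_right: "h w (cscale c u) = cnj c * h w u"
  by (metis scale_left hermitian complex_cnj_mult)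

lemma zero_left: "h 0 w = 0"
  using scale_left[of 0 0 w] by simp

lemma sum_left: "h (\<Sum>i\<in>A. f i) w = (\<Sum>i\<in>A. h (f i) w)"
  by (induction A rule: infinite_finite_induct) (simp_all add: zero_left add_left)

lemma sum_right: "h w (\<Sum>i\<in>A. f i) = (\<Sum>i\<in>A. h w (f i))"
proof -
  have "h w (\<Sum>i\<in>A. f i) = cnj (h (\<Sum>i\<in>A. f i) w)"
    by (rule hermitian)
  also have "\<dots> = (\<Sum>i\<in>A. h w (f i))"
    by (simp add: sum_left hermitian[of w])
  finally show ?thesis .
qed

lemma form_self_real: "h u u = of_real (Re (h u u))"
  using hermitian[of u u] by (metis Reals_cnj_iff complex_is_Real_iff of_real_Re)

section \<open>Orthogonality and Sylvester's law of inertia\<close>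

lemma orthogonal_span:
  assumes "\<And>b. b \<in> B \<Longrightarrow> h b w = 0" "x \<in> cvec.span B"
  shows "h x w = 0"
  using assms(2)
  by (induction rule: cvec.span_induct_alt) (simp_all add: zero_left add_left scale_left assms)

lemma form_diagonal_sum:
  assumes "finite S" "\<forall>u\<in>S. \<forall>v\<in>S. u \<noteq> v \<longrightarrow> h u v = 0"
  shows "h (\<Sum>b\<in>S. cscale (c b) b) (\<Sum>b\<in>S. cscale (c b) b) = (\<Sum>b\<in>S. of_real ((cmod (c b))\<^sup>2) * h b b)"
proof -
  have "h (cscale (c b) b) (\<Sum>b\<in>S. cscale (c b) b) = of_real ((cmod (c b))\<^sup>2) * h b b"
    if "b \<in> S" for b
  proof -
    have "h (cscale (c b) b) (\<Sum>b\<in>S. cscale (c b) b) = (\<Sum>d\<in>S. c b * cnj (c d) * h b d)"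
      by (simp add: sum_right scale_left scale_right mult_ac sum_distrib_left)
    also have "\<dots> = (\<Sum>d\<in>S. if d = b then c b * cnj (c b) * h b b else 0)"
      using assms that by (intro sum.cong) auto
    also have "\<dots> = c b * cnj (c b) * h b b"
      using assms that by simp
    finally show ?thesis
      by (metis complex_norm_square)
  qed
  then show ?thesis
    by (simp add: sum_left)
qed

text \<open>On the span of the positive vectors of \<open>B\<close> the form is positive definite,
  on the span of the remaining vectors of \<open>C\<close> it is nonpositive. The two spans meet
  only in 0, so together they have at most \<open>card C\<close> dimensions.\<close>

lemma card_positive_le:
  assumes "normalized_diagonal_basis V h B" "normalized_diagonal_basis V h C"
  shows "card {u \<in> B. h u u = 1} \<le> card {u \<in> C. h u u = 1}"
proof -
  define P where "P = {u \<in> B. h u u = 1}"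
  define R where "R = {u \<in> C. h u u \<noteq> 1}"
  have B: "finite B" "cvec.independent B" "cvec.span B = V"
      "\<forall>u\<in>B. \<forall>v\<in>B. u \<noteq> v \<longrightarrow> h u v = 0"
    and C: "finite C" "cvec.independent C" "cvec.span C = V"
      "\<forall>u\<in>C. \<forall>v\<in>C. u \<noteq> v \<longrightarrow> h u v = 0" "\<forall>u\<in>C. h u u \<in> {1, -1, 0}"
    using assms by (auto simp: normalized_diagonal_basis_def)
  have PR: "P \<subseteq> B" "R \<subseteq> C" "finite P" "finite R"
    using B C by (auto simp: P_def R_def)
  then have ind: "cvec.independent P" "cvec.independent R"
    using B C cvec.independent_mono by blast+
  have int0: "cvec.span P \<inter> cvec.span R \<subseteq> {0}"
  proof
    fix x assume x: "x \<in> cvec.span P \<inter> cvec.span R"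
    obtain c where c: "x = (\<Sum>b\<in>P. cscale (c b) b)"
      using x PR cvec.span_finite by auto
    obtain d where d: "x = (\<Sum>b\<in>R. cscale (d b) b)"
      using x PR cvec.span_finite by auto
    have "\<forall>u\<in>P. \<forall>v\<in>P. u \<noteq> v \<longrightarrow> h u v = 0" "\<forall>u\<in>R. \<forall>v\<in>R. u \<noteq> v \<longrightarrow> h u v = 0"
      using B C PR by blast+
    then have "h x x = (\<Sum>b\<in>P. of_real ((cmod (c b))\<^sup>2) * h b b)"
      "h x x = (\<Sum>b\<in>R. of_real ((cmod (d b))\<^sup>2) * h b b)"
      using form_diagonal_sum[OF PR(3), of c, folded c] form_diagonal_sum[OF PR(4), of d, folded d]
      by blast+
    then have h1: "Re (h x x) = (\<Sum>b\<in>P. (cmod (c b))\<^sup>2 * Re (h b b))"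
      and h2: "Re (h x x) = (\<Sum>b\<in>R. (cmod (d b))\<^sup>2 * Re (h b b))"
      by (auto dest!: arg_cong[of _ _ Re] simp del: of_real_power)
    have "Re (h x x) = (\<Sum>b\<in>P. (cmod (c b))\<^sup>2)"
      unfolding h1 by (intro sum.cong) (auto simp: P_def)
    moreover have "Re (h x x) \<le> 0"
      unfolding h2 using C(5) by (intro sum_nonpos) (auto simp: R_def mult_nonneg_nonpos)
    ultimately have "(\<Sum>b\<in>P. (cmod (c b))\<^sup>2) = 0"
      by (metis order_antisym sum_nonneg zero_le_power2)
    then have "\<forall>b\<in>P. c b = 0"
      using PR by (simp add: sum_nonneg_eq_0_iff)
    then show "x \<in> {0}"
      by (simp add: c)
  qed
  have "P \<inter> R \<subseteq> cvec.span P \<inter> cvec.span R"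
    by (auto intro: cvec.span_base)
  moreover have "0 \<notin> P"
    using ind cvec.dependent_zero by blast
  ultimately have disj: "P \<inter> R = {}"
    using int0 by blast
  have "P \<union> R \<subseteq> cvec.span C"
    using PR B C cvec.span_superset by blast
  then have "card (P \<union> R) \<le> card C"
    using cvec.independent_span_bound[OF C(1) cvec_independent_Un[OF PR(4) ind int0]] by blast
  moreover have "C = {u \<in> C. h u u = 1} \<union> R"
    by (auto simp: R_def)
  moreover have "card ({u \<in> C. h u u = 1} \<union> R) = card {u \<in> C. h u u = 1} + card R"
    using C PR by (intro card_Un_disjoint) (auto simp: R_def)
  ultimately have "card P \<le> card {u \<in> C. h u u = 1}"
    using card_Un_disjoint[OF PR(3,4) disj] by simp
  then show ?thesis
    by (simp add: P_def)
qed

theorem sylvester_inertia: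
  assumes "normalized_diagonal_basis V h B" "normalized_diagonal_basis V h C"
  shows "card {u \<in> B. h u u = 1} = card {u \<in> C. h u u = 1}"
    and "card {u \<in> B. h u u = -1} = card {u \<in> C. h u u = -1}"
proof -
  show "card {u \<in> B. h u u = 1} = card {u \<in> C. h u u = 1}"
    using assms card_positive_le by (simp add: order_antisym)
  \<comment> \<open>Negative directions of \<open>h\<close> are positive directions of
    \<open>-h\<close>.\<close>
  interpret neg: hermitian_form "\<lambda>u v. - h u v"
    by (rule hermitian_form_uminus)
  have "normalized_diagonal_basis V (\<lambda>u v. - h u v) B" "normalized_diagonal_basis V (\<lambda>u v. - h u v) C"
    using assms unfolding normalized_diagonal_basis_def by auto
  then have "card {u \<in> B. - h u u = 1} = card {u \<in> C. - h u u = 1}"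
    using neg.card_positive_le by (simp add: order_antisym)
  moreover have "- h u u = 1 \<longleftrightarrow> h u u = -1" for u
    by (auto simp: equation_minus_iff)
  ultimately show "card {u \<in> B. h u u = -1} = card {u \<in> C. h u u = -1}"
    by simp
qed

lemma has_signature_if_diagonal_counts:
  assumes "diagonal_counts V h p q"
  shows "has_signature V h (int p, int q)"
proof -
  obtain B where B: "normalized_diagonal_basis V h B"
      and pq: "card {u \<in> B. h u u = 1} = p" "card {u \<in> B. h u u = -1} = q"
    using assms by (auto simp: diagonal_counts_def)
  have "card {u \<in> C. h u u = 1} = p" "card {u \<in> C. h u u = -1} = q"
    if "normalized_diagonal_basis V h C" for C
    using sylvester_inertia[OF that B] pq by simp_all
  then have "\<forall>C. normalized_diagonal_basis V h C \<longrightarrow>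
      (int p, int q) = (int (card {u \<in> C. h u u = 1}), int (card {u \<in> C. h u u = -1}))"
    by (metis (no_types, lifting))
  with B show ?thesis
    unfolding has_signature_def by (intro conjI hermitian_form_on exI)
qed

section \<open>Enlarging a diagonalized subspace by orthogonal vectors\<close>

lemma diagonal_counts_zero: "diagonal_counts {0} h 0 0"
  unfolding diagonal_counts_def normalized_diagonal_basis_def
  by (intro exI[of _ "{}"]) (auto simp: cvec.independent_empty)

lemma diagonal_counts_insert:
  assumes "diagonal_counts W h p q" "w \<notin> W" and perp: "\<And>v. v \<in> W \<Longrightarrow> h v w = 0"
  shows "diagonal_counts (cvec.span (insert w W)) h
    (if Re (h w w) > 0 then Suc p else p) (if Re (h w w) < 0 then Suc q else q)"
proof -
  obtain B where B: "finite B" "cvec.independent B" "cvec.span B = W"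
      "\<forall>u\<in>B. \<forall>v\<in>B. u \<noteq> v \<longrightarrow> h u v = 0" "\<forall>u\<in>B. h u u \<in> {1, -1, 0}"
    and pq: "card {u \<in> B. h u u = 1} = p" "card {u \<in> B. h u u = -1} = q"
    using assms(1) by (auto simp: diagonal_counts_def normalized_diagonal_basis_def)
  define r where "r = Re (h w w)"
  \<comment> \<open>The factor normalizes \<open>h w w\<close> to its sign; a null vector keeps its
    length, so that \<open>u\<close> still spans the same line as \<open>w\<close>.\<close>
  define a where "a = (if r = 0 then 1 else 1 / sqrt \<bar>r\<bar>)"
  define u where "u = cscale (of_real a) w"
  have a: "a \<noteq> 0" "a\<^sup>2 * r = sgn r"
    by (auto simp: a_def power_divide sgn_real_def)
  have w: "w = cscale (of_real (1 / a)) u"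
    using a by (simp add: u_def cscale_def)
  have "h u u = of_real (a\<^sup>2 * r)"
    using form_self_real[of w] by (simp add: u_def scale_left scale_right r_def power2_eq_square)
  then have huu: "h u u = of_real (sgn r)"
    by (simp only: a)
  have uW: "u \<notin> W"
    using assms(2) w cvec.span_scale[of u B "of_real (1 / a)"] B(3) by metis
  then have uB: "u \<notin> B"
    using B(3) cvec.span_base by blast
  have hu: "h b u = 0" "h u b = 0" if "b \<in> B" for b
  proof -
    have "b \<in> W"
      using that B(3) cvec.span_base by blast
    then have "h b w = 0"
      by (rule perp)
    then show "h b u = 0"
      by (simp add: u_def scale_right)
    then show "h u b = 0"
      using hermitian[of u b] by simp
  qed
  have "cvec.span (insert u B) = cvec.span (insert w W)"
  proof (subst cvec.span_eq, intro conjI subsetI)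
    fix x assume "x \<in> insert u B"
    then show "x \<in> cvec.span (insert w W)"
      using B(3) by (auto simp: u_def intro: cvec.span_scale cvec.span_base)
  next
    fix x assume x: "x \<in> insert w W"
    show "x \<in> cvec.span (insert u B)"
    proof (cases "x = w")
      case True
      then show ?thesis
        using cvec.span_scale[OF cvec.span_base[of u "insert u B"]] w by (metis insertI1)
    next
      case False
      then show ?thesis
        using x B(3) cvec.span_mono[of B "insert u B"] by auto
    qed
  qed
  then have "normalized_diagonal_basis (cvec.span (insert w W)) h (insert u B)"
    unfolding normalized_diagonal_basis_def
    using B uW hu huu by (auto simp: cvec.independent_insert sgn_real_def)
  moreover have "{v \<in> insert u B. h v v = c} =
      (if h u u = c then insert u {v \<in> B. h v v = c} else {v \<in> B. h v v = c})" for c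
    by auto
  then have "card {v \<in> insert u B. h v v = c} =
      (if h u u = c then Suc (card {v \<in> B. h v v = c}) else card {v \<in> B. h v v = c})" for c
    using uB B(1) by simp
  ultimately show ?thesis
    unfolding diagonal_counts_def
    by (intro exI[of _ "insert u B"]) (auto simp: pq huu r_def sgn_real_def)
qed

text \<open>With \<open>\<alpha> = (1 - h e e) / (2 h v e)\<close> and \<open>\<beta> = (-1 - h e e) / (2 h v e)\<close>, the vectors
  \<open>\<alpha> v + e\<close> and \<open>\<beta> v + e\<close> are orthogonal and have norms \<open>1\<close> and \<open>-1\<close>.\<close>

lemma diagonal_counts_hyperbolic:
  assumes W: "diagonal_counts W h p q"
    and perp: "\<And>x. x \<in> W \<Longrightarrow> h x v = 0" "\<And>x. x \<in> W \<Longrightarrow> h x e = 0"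
    and v: "h v v = 0" "h v e \<noteq> 0"
  shows "diagonal_counts (cvec.span (insert e (insert v W))) h (Suc p) (Suc q)"
proof -
  define \<alpha> where "\<alpha> = (1 - h e e) / (2 * h v e)"
  define \<beta> where "\<beta> = (-1 - h e e) / (2 * h v e)"
  define x where "x = cscale \<alpha> v + e"
  define y where "y = cscale \<beta> v + e"
  have ev: "h e v = cnj (h v e)" "cnj (h e e) = h e e"
    using hermitian by metis+
  have hxx: "h x x = 1" and hyy: "h y y = -1" and hxy: "h x y = 0"
    using v by (auto simp: x_def y_def \<alpha>_def \<beta>_def add_left add_right scale_left scale_right ev field_simps)
  \<comment> \<open>A vector of nonzero norm is not orthogonal to itself, hence lies in no set
    orthogonal to it.\<close>
  have not_perp: "z \<notin> S" if "h z z \<noteq> 0" "\<And>s. s \<in> S \<Longrightarrow> h s z = 0" for z S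
    using that by blast
  have Wx: "h s x = 0" and Wy: "h s y = 0" if "s \<in> W" for s
    using perp that by (simp_all add: x_def y_def add_right scale_right)
  have 1: "diagonal_counts (cvec.span (insert x W)) h (Suc p) q"
    using diagonal_counts_insert[OF W not_perp[OF _ Wx] Wx] hxx by simp
  have perp_y: "h s y = 0" if "s \<in> cvec.span (insert x W)" for s
    using Wy hxy by (rule_tac orthogonal_span[OF _ that]) blast
  have "diagonal_counts (cvec.span (insert y (cvec.span (insert x W)))) h (Suc p) (Suc q)"
    using diagonal_counts_insert[OF 1 not_perp[OF _ perp_y] perp_y] hyy by simp
  moreover have "cvec.span (insert y (cvec.span (insert x W))) = cvec.span (insert e (insert v W))"
  proof (subst cvec.span_eq, intro conjI)
    let ?T = "cvec.span (insert e (insert v W))"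
    have sup: "insert e (insert v W) \<subseteq> ?T"
      by (rule cvec.span_superset)
    then have "v \<in> ?T" "e \<in> ?T"
      by simp_all
    then have T: "x \<in> ?T" "y \<in> ?T"
      by (simp_all add: x_def y_def cvec.span_add cvec.span_scale)
    then have "cvec.span (insert x W) \<subseteq> ?T"
      using sup by (intro cvec.span_minimal cvec.subspace_span) blast
    with T show "insert y (cvec.span (insert x W)) \<subseteq> ?T"
      by simp
    let ?S = "cvec.span (insert y (cvec.span (insert x W)))"
    have xW: "insert x W \<subseteq> ?S"
      using cvec.span_superset[of "insert x W"] cvec.span_superset[of "insert y (cvec.span (insert x W))"]
      by blast
    have xy: "x \<in> ?S" "y \<in> ?S"
      using xW cvec.span_superset[of "insert y (cvec.span (insert x W))"] by blast+
    \<comment> \<open>The difference \<open>x - y\<close> is a nonzero multiple of \<open>v\<close>;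
      this recovers \<open>v\<close>, and then \<open>e\<close> from \<open>x\<close>.\<close>
    have "\<alpha> - \<beta> = 1 / h v e"
      using v by (simp add: \<alpha>_def \<beta>_def field_simps)
    moreover have "x - y = cscale (\<alpha> - \<beta>) v"
      by (simp add: x_def y_def cvec.scale_left_diff_distrib)
    ultimately have "cscale (h v e) (x - y) = v"
      using v by simp
    then have vS: "v \<in> ?S"
      using xy by (metis cvec.span_scale cvec.span_diff)
    have "e = x - cscale \<alpha> v"
      by (simp add: x_def)
    then have "e \<in> ?S"
      using xy vS by (metis cvec.span_scale cvec.span_diff)
    with vS xW show "insert e (insert v W) \<subseteq> ?S"
      by blast
  qed
  ultimately show ?thesis
    by (simp only:)
qed

end

section \<open>Coordinates on the polygon space\<close>

lemma sum_fun_apply: "(\<Sum>i\<in>A. f i) x = (\<Sum>i\<in>A. f i x)" for f :: "'i \<Rightarrow> 'a \<Rightarrow> 'b::comm_monoid_add"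
  by (induction A rule: infinite_finite_induct) (simp_all add: plus_fun_apply zero_fun_apply)

lemma span_insert_span: "cvec.span (insert a (cvec.span S)) = cvec.span (insert a S)"
  by (rule set_eqI) (simp only: cvec.span_breakdown_eq cvec.span_span)

section \<open>Full turns, floors and signs of sines\<close>

lemma cis_eq_1_iff: "cis t = 1 \<longleftrightarrow> t / (2 * pi) \<in> \<int>"
proof
  assume "cis t = 1"
  then have "cos t = 1"
    by (metis cis.sel(1) one_complex.sel(1))
  then show "t / (2 * pi) \<in> \<int>"
    by (auto simp: cos_one_2pi_int)
next
  assume "t / (2 * pi) \<in> \<int>"
  then show "cis t = 1"
    using cis_multiple_2pi[of "t / (2 * pi)"] by simp
qed

text \<open>Separates the phase from the real factor, so that the phases can cancel in the norm of a
  fan.\<close>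

lemma one_minus_cis: "1 - cis t = - 2 * \<i> * cis (t / 2) * of_real (sin (t / 2))"
  using cos_double_sin[of "t / 2"] sin_double[of "t / 2"]
  by (simp add: complex_eq_iff power2_eq_square)

text \<open>The cosine is the sign given by the parity of the floor; the other factor is positive
  off the integers. So floors decide the signs of products of sines.\<close>

lemma sin_pi_frac: "sin (pi * s) = cos (pi * of_int \<lfloor>s\<rfloor>) * sin (pi * frac s)" for s :: real
proof -
  have "sin (pi * s) = sin (pi * of_int \<lfloor>s\<rfloor> + pi * frac s)"
    by (simp add: frac_def algebra_simps)
  then show ?thesis
    by (simp add: sin_add)
qed

lemma sin_pi_frac_pos:
  fixes s :: real
  assumes "s \<notin> \<int>"
  shows "sin (pi * frac s) > 0"
  using assms frac_lt_1[of s] by (intro sin_gt_zero) (auto simp: frac_gt_0_iff)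

lemma sin_pi_mult_pos:
  fixes s t :: real
  assumes "s \<notin> \<int>" "t \<notin> \<int>" "\<lfloor>t\<rfloor> = \<lfloor>s\<rfloor>"
  shows "sin (pi * s) * sin (pi * t) > 0"
  using assms sin_pi_frac_pos[of s] sin_pi_frac_pos[of t]
  by (simp add: sin_pi_frac[of s] sin_pi_frac[of t])

lemma sin_pi_mult_neg:
  fixes s t :: real
  assumes "s \<notin> \<int>" "t \<notin> \<int>" "\<lfloor>t\<rfloor> = \<lfloor>s\<rfloor> + 1"
  shows "sin (pi * s) * sin (pi * t) < 0"
  using assms sin_pi_frac_pos[of s] sin_pi_frac_pos[of t]
  by (auto simp: sin_pi_frac[of s] sin_pi_frac[of t] cos_npi_int mult_pos_pos simp del: of_int_add)

text \<open>A step shorter than 1 passes at most one integer. Landing exactly on an integer falls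
  under \<open>jump\<close>.\<close>

lemma floor_step:
  fixes s t :: real
  assumes "s < t" "t < s + 1"
  obtains (same) "\<lfloor>t\<rfloor> = \<lfloor>s\<rfloor>" "t \<notin> \<int>" | (jump) "\<lfloor>t\<rfloor> = \<lfloor>s\<rfloor> + 1"
proof -
  have "\<lfloor>t\<rfloor> = \<lfloor>s\<rfloor> \<or> \<lfloor>t\<rfloor> = \<lfloor>s\<rfloor> + 1"
    using assms by linarith
  moreover have "t \<notin> \<int>" if "\<lfloor>t\<rfloor> = \<lfloor>s\<rfloor>"
    using that assms by (auto elim!: Ints_cases) linarith
  ultimately show ?thesis
    using that by blast
qed

text \<open>The apex of the isosceles triangle with apex angle \<open>t\<close> and base from \<open>0\<close> to \<open>1\<close>.\<close>

definition apex :: "real \<Rightarrow> complex" where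
  "apex t = 1 / (1 - cis t)"

text \<open>The apex lies on the perpendicular bisector of the base, so its real part is
  1/2.\<close>

lemma cnj_apex:
  assumes "cis t \<noteq> 1"
  shows "cnj (apex t) = 1 - apex t"
proof -
  have c: "cis t * cis (- t) = 1"
    by (simp add: cis_mult)
  then have "cis (- t) \<noteq> 1"
    using assms by auto
  then have "1 / (1 - cis (- t)) = 1 - 1 / (1 - cis t)"
    using assms c by (simp add: field_simps)
  then show ?thesis
    by (simp add: apex_def cis_cnj)
qed

text \<open>Solves the defining equation of the polygon space for the even-indexed vertex; the two
  weights sum to 1.\<close>

lemma apex_iff:
  assumes "cis t \<noteq> 1"
  shows "cis t * (a - z) = b - z \<longleftrightarrow> z = cnj (apex t) * a + apex t * b"
proof -
  have "cis t * (a - z) = b - z \<longleftrightarrow> (1 - cis t) * z = b - cis t * a"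
    by (auto simp: algebra_simps)
  also have "\<dots> \<longleftrightarrow> z = apex t * (b - cis t * a)"
    using assms by (simp add: apex_def field_simps)
  also have "apex t * (1 - cis t) = 1"
    using assms by (simp add: apex_def)
  then have "apex t * (b - cis t * a) = cnj (apex t) * a + apex t * b"
    unfolding cnj_apex[OF assms] by algebra
  finally show ?thesis .
qed

text \<open>The base vertices are \<open>z\<^sub>1, z\<^sub>3, \<dots>\<close>; the even-indexed vertices are the apexes of isosceles triangles
  over consecutive base vertices.\<close>

definition base :: "(nat \<Rightarrow> complex) \<Rightarrow> nat \<Rightarrow> complex" where
  "base z i = z (2 * i + 1)"

interpretation area: hermitian_form "area_form n"
proof
  fix u v w :: "nat \<Rightarrow> complex" and c
  show "area_form n (u + v) w = area_form n u w + area_form n v w"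
    by (simp add: area_form_def plus_fun_apply sum.distrib sum_subtractf algebra_simps)
  show "area_form n (cscale c u) w = c * area_form n u w"
    by (simp add: area_form_def cscale_def sum_distrib_left algebra_simps)
  show "area_form n w u = cnj (area_form n u w)"
    by (simp add: area_form_def sum_subtractf algebra_simps)
qed

text \<open>The polygon with \<open>base z j = 1\<close> and all other base vertices \<open>0\<close>.\<close>

definition corner :: "(nat \<Rightarrow> real) \<Rightarrow> nat \<Rightarrow> nat \<Rightarrow> complex" where
  "corner \<kappa> j = (\<lambda>m. if m = 2 * j then apex (\<kappa> j) else if m = 2 * j + 1 then 1
     else if m = 2 * j + 2 then cnj (apex (\<kappa> (j + 1))) else 0)"

lemma base_corner: "base (corner \<kappa> j) i = (if i = j then 1 else 0)"
  by (auto simp: base_def corner_def; presburger)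

lemma corner_apex: "corner \<kappa> j (2 * i + 2) =
    (if j = Suc i then apex (\<kappa> (Suc i)) else if j = i then cnj (apex (\<kappa> (Suc i))) else 0)"
proof -
  have "2 * i + 2 = 2 * j \<longleftrightarrow> j = Suc i" "2 * i + 2 \<noteq> 2 * j + 1" "2 * i + 2 = 2 * j + 2 \<longleftrightarrow> j = i"
    by presburger+
  then show ?thesis
    unfolding corner_def by auto
qed

section \<open>Polygons with prescribed angles\<close>

locale polygon =
  fixes n :: nat and \<kappa> :: "nat \<Rightarrow> real"
  assumes n: "n > 1" and \<kappa>: "i \<in> {1..n} \<Longrightarrow> 0 < \<kappa> i \<and> \<kappa> i < 2 * pi"
begin

definition angle :: "nat \<Rightarrow> real" where
  "angle k = (\<Sum>i = 1..k. \<kappa> i)"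

definition turns :: "nat \<Rightarrow> real" where
  "turns k = angle k / (2 * pi)"

lemma angle_Suc: "angle (Suc k) = angle k + \<kappa> (Suc k)"
  by (simp add: angle_def)

lemma turns_Suc:
  assumes "k < n"
  shows "turns k < turns (Suc k)" "turns (Suc k) < turns k + 1"
  using \<kappa>[of "Suc k"] assms by (simp_all add: turns_def angle_Suc field_simps)

lemma turns_0: "turns 0 = 0"
  by (simp add: turns_def angle_def)

lemma cis_angle_eq_1_iff: "cis (angle k) = 1 \<longleftrightarrow> turns k \<in> \<int>"
  by (simp add: cis_eq_1_iff turns_def)

lemma cis_\<kappa>: "i \<in> {1..n} \<Longrightarrow> cis (\<kappa> i) \<noteq> 1"
proof
  assume i: "i \<in> {1..n}" and "cis (\<kappa> i) = 1"
  then obtain m :: int where m: "\<kappa> i / (2 * pi) = of_int m"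
    by (auto simp: cis_eq_1_iff elim: Ints_cases)
  have "0 < \<kappa> i / (2 * pi)" "\<kappa> i / (2 * pi) < 1"
    using \<kappa>[OF i] by auto
  then show False
    unfolding m by simp
qed

text \<open>The cyclic case \<open>i = n\<close> needs no exception here: sequences vanish beyond
  \<open>2 * n\<close>, so \<open>base z n = 0\<close>, which agrees with
  \<open>z 1 = 0\<close>.\<close>

lemma polygon_space_iff: "z \<in> polygon_space n \<kappa> \<longleftrightarrow> (\<forall>j. j \<notin> {1..2 * n} \<longrightarrow> z j = 0) \<and> base z 0 = 0 \<and>
    (\<forall>i<n. z (2 * i + 2) = cnj (apex (\<kappa> (Suc i))) * base z i + apex (\<kappa> (Suc i)) * base z (Suc i))"
proof -
  have "exp (\<i> * complex_of_real (\<kappa> (Suc i))) * (z (2 * Suc i - 1) - z (2 * Suc i)) =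
        (if Suc i = n then z 1 else z (2 * Suc i + 1)) - z (2 * Suc i) \<longleftrightarrow>
      z (2 * i + 2) = cnj (apex (\<kappa> (Suc i))) * base z i + apex (\<kappa> (Suc i)) * base z (Suc i)"
    if "i < n" "z 1 = 0" "z (2 * n + 1) = 0" for i
    using that apex_iff[OF cis_\<kappa>[of "Suc i"]] by (auto simp: cis_conv_exp base_def)
  note step = this
  have "{1..n} = Suc ` {..<n}"
    by (simp add: image_Suc_lessThan)
  then have shift: "(\<forall>i\<in>{1..n}. P i) \<longleftrightarrow> (\<forall>i<n. P (Suc i))" for P
    by auto
  have base0: "base z 0 = z 1"
    by (simp add: base_def)
  show ?thesis
    unfolding polygon_space_def mem_Collect_eq shift base0
    by (intro conj_cong refl all_cong step) simp_all
qed

lemma subspace_polygon_space: "cvec.subspace (polygon_space n \<kappa>)"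
  by (intro cvec.subspaceI) (auto simp: polygon_space_iff base_def cscale_def plus_fun_apply
      zero_fun_apply distrib_left mult.left_commute)

lemma polygon_even:
  assumes "z \<in> polygon_space n \<kappa>" "i < n"
  shows "z (2 * i + 2) = cnj (apex (\<kappa> (Suc i))) * base z i + apex (\<kappa> (Suc i)) * base z (Suc i)"
  using assms polygon_space_iff by blast

lemma polygon_eqI:
  assumes z: "z \<in> polygon_space n \<kappa>" and w: "w \<in> polygon_space n \<kappa>"
    and eq: "\<And>i. i \<in> {1..<n} \<Longrightarrow> base z i = base w i"
  shows "z = w"
proof
  have odd_eq: "base z i = base w i" for i
  proof -
    \<comment> \<open>Index 0 is the fixed vertex, and from \<open>n\<close> on the base vertices
      lie in the zero tail of the sequence.\<close>
    consider "i = 0" | "i \<in> {1..<n}" | "i \<ge> n"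
      by force
    then show ?thesis
      using eq z w by cases (auto simp: polygon_space_def base_def)
  qed
  fix m
  show "z m = w m"
  proof (cases "odd m")
    case True
    then show ?thesis
      using odd_eq by (auto simp: base_def elim: oddE)
  next
    case False
    then obtain i where i: "m = 2 * i"
      by (auto elim: evenE)
    show ?thesis
    proof (cases "i \<in> {1..n}")
      case True
      then obtain l where l: "i = Suc l" "l < n"
        by (cases i) auto
      then show ?thesis
        using polygon_even[OF z l(2)] polygon_even[OF w l(2)] odd_eq[of l] odd_eq[of "Suc l"]
        by (simp add: i)
    next
      case False
      then have "m \<notin> {1..2 * n}"
        by (auto simp: i)
      then show ?thesis
        using z w by (simp add: polygon_space_def)
    qed
  qed
qed

lemma corner_in_polygon_space:
  assumes "j \<in> {1..<n}"
  shows "corner \<kappa> j \<in> polygon_space n \<kappa>"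
  unfolding polygon_space_iff base_corner corner_apex using assms by (auto simp: corner_def)

lemma span_corner: "cvec.span (corner \<kappa> ` {1..<n}) = polygon_space n \<kappa>"
proof
  show sub: "cvec.span (corner \<kappa> ` {1..<n}) \<subseteq> polygon_space n \<kappa>"
    using corner_in_polygon_space by (intro cvec.span_minimal subspace_polygon_space) auto
  show "polygon_space n \<kappa> \<subseteq> cvec.span (corner \<kappa> ` {1..<n})"
  proof
    fix z assume z: "z \<in> polygon_space n \<kappa>"
    define w where "w = (\<Sum>j\<in>{1..<n}. cscale (base z j) (corner \<kappa> j))"
    have w: "w \<in> cvec.span (corner \<kappa> ` {1..<n})"
      unfolding w_def by (auto intro!: cvec.span_sum cvec.span_scale intro: cvec.span_base)
    have "base w i = base z i" if "i \<in> {1..<n}" for i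
    proof -
      have "base w i = (\<Sum>j\<in>{1..<n}. if j = i then base z i else 0)"
        unfolding w_def base_def sum_fun_apply cscale_def base_corner[unfolded base_def] by (intro sum.cong) auto
      then show ?thesis
        using that by simp
    qed
    then have "w = z"
      using w z sub by (intro polygon_eqI) auto
    then show "z \<in> cvec.span (corner \<kappa> ` {1..<n})"
      using w by simp
  qed
qed

text \<open>A row of the tridiagonal matrix: a corner is supported on three consecutive indices, so
  only the base vertex itself and its two neighbours enter.\<close>

lemma area_form_corner:
  assumes z: "z \<in> polygon_space n \<kappa>" and l: "Suc l < n"
  shows "area_form n z (corner \<kappa> (Suc l)) = \<i> / 2 * (cnj (apex (\<kappa> (Suc l))) * base z l
    + (apex (\<kappa> (Suc l)) + apex (\<kappa> (Suc (Suc l))) - 1) * base z (Suc l)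
    - apex (\<kappa> (Suc (Suc l))) * base z (Suc (Suc l)))"
proof -
  let ?w = "corner \<kappa> (Suc l)"
  let ?f = "\<lambda>i. z i * cnj (?w (i + 1)) - z (i + 1) * cnj (?w i)"
  have "z (Suc (2 * n)) = 0"
    using z by (simp add: polygon_space_def)
  moreover have "?w (Suc (2 * n)) = 0"
    using l by (simp add: corner_def)
  \<comment> \<open>Adding this vanishing term makes room for the index \<open>2 * l + 4\<close>,
    which equals \<open>2 * n\<close> for the last corner.\<close>
  ultimately have "?f (2 * n) = 0"
    by simp
  moreover have "{1..2 * n} = insert (2 * n) {1..2 * n - 1}"
    using n by auto
  ultimately have "sum ?f {1..2 * n - 1} = sum ?f {1..2 * n}"
    using n by simp
  also have "\<dots> = sum ?f {2 * l + 1, 2 * l + 2, 2 * l + 3, 2 * l + 4}"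
    using l by (intro sum.mono_neutral_right) (auto simp: corner_def)
  also have "\<dots> = ?f (2 * l + 1) + ?f (2 * l + 2) + ?f (2 * l + 3) + ?f (2 * l + 4)"
    by simp
  also have "\<dots> = z (2 * l + 1) * cnj (apex (\<kappa> (Suc l))) + (z (2 * l + 2) - z (2 * l + 3) * cnj (apex (\<kappa> (Suc l))))
     + (z (2 * l + 3) * apex (\<kappa> (Suc (Suc l))) - z (2 * l + 4)) - z (2 * l + 5) * apex (\<kappa> (Suc (Suc l)))"
    by (simp add: corner_def eval_nat_numeral)
  finally have *: "area_form n z ?w = \<i> / 4 * (z (2 * l + 1) * cnj (apex (\<kappa> (Suc l))) + (z (2 * l + 2) - z (2 * l + 3) * cnj (apex (\<kappa> (Suc l))))
     + (z (2 * l + 3) * apex (\<kappa> (Suc (Suc l))) - z (2 * l + 4)) - z (2 * l + 5) * apex (\<kappa> (Suc (Suc l))))"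
    by (simp add: area_form_def)
  have e: "z (2 * l + 2) = cnj (apex (\<kappa> (Suc l))) * base z l + apex (\<kappa> (Suc l)) * base z (Suc l)"
    "z (2 * l + 4) = cnj (apex (\<kappa> (Suc (Suc l)))) * base z (Suc l) + apex (\<kappa> (Suc (Suc l))) * base z (Suc (Suc l))"
    using polygon_even[OF z, of l] polygon_even[OF z, of "Suc l"] l by (simp_all add: eval_nat_numeral)
  have c: "cnj (apex (\<kappa> (Suc l))) = 1 - apex (\<kappa> (Suc l))"
    "cnj (apex (\<kappa> (Suc (Suc l)))) = 1 - apex (\<kappa> (Suc (Suc l)))"
    using l by (auto intro!: cnj_apex cis_\<kappa>)
  have idx: "z (2 * l + 1) = base z l" "z (2 * l + 3) = base z (Suc l)" "z (2 * l + 5) = base z (Suc (Suc l))"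
    by (simp_all add: base_def eval_nat_numeral)
  show ?thesis
    unfolding * e idx c by (simp add: field_simps)
qed

lemma corner_orthogonal:
  assumes "Suc i < j" "j < n" "1 \<le> i"
  shows "area_form n (corner \<kappa> i) (corner \<kappa> j) = 0"
proof -
  obtain l where j: "j = Suc l" using assms by (cases j) auto
  then show ?thesis
    using assms area_form_corner[OF corner_in_polygon_space, of i l] by (simp add: base_corner)
qed

text \<open>If \<open>base z i = 1 - cis (angle i)\<close> for all \<open>i\<close>, all the isosceles triangles have the same apex \<open>1\<close>,
  about which the base vertices rotate. The fan is such a polygon as far as \<open>base z k\<close>; this is
  why it is orthogonal to \<open>corner \<kappa> j\<close> for \<open>j < k\<close>.\<close>

definition fan :: "nat \<Rightarrow> nat \<Rightarrow> complex" where
  "fan k = (\<Sum>j = 1..k. cscale (1 - cis (angle j)) (corner \<kappa> j))"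

lemma base_fan: "base (fan k) m = (if m \<le> k then 1 - cis (angle m) else 0)"
proof -
  have "base (fan k) m = (\<Sum>j = 1..k. if j = m then 1 - cis (angle m) else 0)"
    unfolding fan_def base_def sum_fun_apply cscale_def base_corner[unfolded base_def]
    by (intro sum.cong) auto
  then show ?thesis
    by (cases "m = 0") (auto simp: angle_def)
qed

lemma fan_in_polygon_space:
  assumes "k < n"
  shows "fan k \<in> polygon_space n \<kappa>"
  unfolding fan_def using assms
  by (intro cvec.subspace_sum cvec.subspace_scale subspace_polygon_space corner_in_polygon_space) auto

text \<open>The row of a corner annihilates the untruncated sequence
  \<open>1 - cis (angle i)\<close>. Pairings of a fan with a corner thus come only from the
  truncation.\<close>

lemma fan_telescope:
  assumes "Suc l < n"
  shows "cnj (apex (\<kappa> (Suc l))) * (1 - cis (angle l))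
    + (apex (\<kappa> (Suc l)) + apex (\<kappa> (Suc (Suc l))) - 1) * (1 - cis (angle (Suc l)))
    = apex (\<kappa> (Suc (Suc l))) * (1 - cis (angle (Suc (Suc l))))"
proof -
  let ?e = "cis (\<kappa> (Suc l))" and ?e' = "cis (\<kappa> (Suc (Suc l)))" and ?p = "cis (angle l)"
  have ne: "?e \<noteq> 1" "?e' \<noteq> 1"
    using assms by (auto intro!: cis_\<kappa>)
  have a: "apex (\<kappa> (Suc l)) * (1 - ?e) = 1" "apex (\<kappa> (Suc (Suc l))) * (1 - ?e') = 1"
    using ne by (simp_all add: apex_def)
  have s: "cis (angle (Suc l)) = ?p * ?e" "cis (angle (Suc (Suc l))) = ?p * ?e * ?e'"
    by (simp_all add: angle_Suc cis_mult)
  show ?thesis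
    unfolding s cnj_apex[OF ne(1)] using a by algebra
qed

lemma fan_corner_below:
  assumes "1 \<le> j" "j < k" "k < n"
  shows "area_form n (fan k) (corner \<kappa> j) = 0"
proof -
  obtain l where j: "j = Suc l" using assms by (cases j) auto
  then show ?thesis
    using assms area_form_corner[OF fan_in_polygon_space, of k l] fan_telescope[of l]
    by (simp add: base_fan)
qed

text \<open>Truncation removes the last of the three neighbouring terms, so the pairing equals the
  missing term.\<close>

lemma fan_corner_top:
  assumes "1 \<le> k" "k < n"
  shows "area_form n (fan k) (corner \<kappa> k) = \<i> / 2 * (apex (\<kappa> (Suc k)) * (1 - cis (angle (Suc k))))"
proof -
  obtain l where j: "k = Suc l" using assms by (cases k) auto
  then show ?thesis
    using assms area_form_corner[OF fan_in_polygon_space, of k l] fan_telescope[of l]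
    by (simp add: base_fan)
qed

lemma fan_corner_above:
  assumes "Suc k < n"
  shows "area_form n (fan k) (corner \<kappa> (Suc k)) = \<i> / 2 * (cnj (apex (\<kappa> (Suc k))) * (1 - cis (angle k)))"
  using assms area_form_corner[OF fan_in_polygon_space, of k k]
  by (simp add: base_fan)

text \<open>With the second argument expanded into corners, only the top corner contributes.\<close>

lemma fan_fan:
  assumes "1 \<le> k" "k < n"
  shows "area_form n (fan k) (fan k) =
    - of_real (sin (pi * turns k) * sin (pi * turns (Suc k)) / sin (\<kappa> (Suc k) / 2))"
proof -
  let ?x = "angle k / 2" and ?b = "\<kappa> (Suc k) / 2"
  have b: "sin ?b > 0"
    using \<kappa>[of "Suc k"] assms by (intro sin_gt_zero) auto
  have "area_form n (fan k) (fan k) =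
    (\<Sum>j = 1..k. cnj (1 - cis (angle j)) * area_form n (fan k) (corner \<kappa> j))"
    by (subst (2) fan_def) (simp only: area.sum_right area.scale_right)
  also have "\<dots> = (\<Sum>j = 1..k. if j = k then cnj (1 - cis (angle k)) * area_form n (fan k) (corner \<kappa> k) else 0)"
    using assms fan_corner_below by (intro sum.cong) auto
  also have "\<dots> = cnj (1 - cis (angle k)) * area_form n (fan k) (corner \<kappa> k)"
    using assms by simp
  also have "\<dots> = cnj (1 - cis (angle k)) * (\<i> / 2 * ((1 - cis (angle (Suc k))) / (1 - cis (\<kappa> (Suc k)))))"
    using assms by (simp add: fan_corner_top apex_def)
  also have "\<dots> = - (cis (- ?x) * cis (angle (Suc k) / 2) / cis ?b) *
      of_real (sin ?x * sin (angle (Suc k) / 2) / sin ?b)"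
    unfolding one_minus_cis using b by (simp add: cis_cnj field_simps)
  \<comment> \<open>The phases cancel because \<open>angle (Suc k) / 2\<close> is the sum of
    \<open>?x\<close> and \<open>?b\<close>.\<close>
  also have "cis (- ?x) * cis (angle (Suc k) / 2) / cis ?b = 1"
    by (simp add: cis_mult cis_divide angle_Suc add_divide_distrib)
  finally show ?thesis
    by (simp add: turns_def)
qed

subsection \<open>Diagonalization\<close>

abbreviation "flag k \<equiv> cvec.span (corner \<kappa> ` {1..k})"

lemma flag_Suc: "flag (Suc k) = cvec.span (insert (corner \<kappa> (Suc k)) (flag k))"
proof -
  have "corner \<kappa> ` {1..Suc k} = insert (corner \<kappa> (Suc k)) (corner \<kappa> ` {1..k})"
    by (simp add: atLeastAtMostSuc_conv)
  then show ?thesis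
    by (simp only: span_insert_span)
qed

lemma fan_Suc: "fan (Suc k) = fan k + cscale (1 - cis (angle (Suc k))) (corner \<kappa> (Suc k))"
  by (simp add: fan_def)

lemma fan_in_flag: "fan k \<in> flag k"
  unfolding fan_def by (intro cvec.span_sum cvec.span_scale cvec.span_base) auto

text \<open>The top corner has coefficient \<open>1 - cis (angle (Suc k))\<close> in the fan, which
  is nonzero off full turns; the fan can then replace that corner.\<close>

lemma flag_Suc_fan:
  assumes "turns (Suc k) \<notin> \<int>"
  shows "flag (Suc k) = cvec.span (insert (fan (Suc k)) (flag k))"
proof -
  let ?S = "cvec.span (insert (fan (Suc k)) (flag k))" and ?c = "1 - cis (angle (Suc k))"
  have c: "?c \<noteq> 0"
    using assms cis_angle_eq_1_iff by auto
  have sub: "flag k \<subseteq> ?S" "fan (Suc k) \<in> ?S"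
    using cvec.span_superset[of "insert (fan (Suc k)) (flag k)"] by blast+
  have "corner \<kappa> (Suc k) = cscale (1 / ?c) (fan (Suc k) - fan k)"
    using c by (simp add: fan_Suc)
  moreover have "fan k \<in> ?S"
    using sub fan_in_flag by blast
  ultimately have "corner \<kappa> (Suc k) \<in> ?S"
    using sub by (simp only: cvec.span_scale cvec.span_diff)
  then have "flag (Suc k) \<subseteq> ?S"
    unfolding flag_Suc using sub by (intro cvec.span_minimal cvec.subspace_span) blast
  moreover have "flag k \<subseteq> flag (Suc k)"
    by (intro cvec.span_mono image_mono) auto
  then have "?S \<subseteq> flag (Suc k)"
    using fan_in_flag by (intro cvec.span_minimal cvec.subspace_span) blast
  ultimately show ?thesis
    by (rule antisym)
qed

lemma base_flag_eq_0:
  assumes "v \<in> flag k" "k < m"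
  shows "base v m = 0"
  using assms(1)
  by (induction rule: cvec.span_induct_alt) (use assms(2) base_corner in \<open>auto simp: cscale_def base_def plus_fun_apply zero_fun_apply\<close>)

lemma flag_orthogonal_fan:
  assumes "v \<in> flag k" "Suc k < n"
  shows "area_form n v (fan (Suc k)) = 0"
proof (rule area.orthogonal_span[OF _ assms(1)])
  fix b assume "b \<in> corner \<kappa> ` {1..k}"
  then have "area_form n (fan (Suc k)) b = 0"
    using fan_corner_below assms(2) by auto
  then show "area_form n b (fan (Suc k)) = 0"
    using area.hermitian[of n "fan (Suc k)" b] by simp
qed

lemma flag_orthogonal_corner:
  assumes "v \<in> flag k" "Suc (Suc k) < n"
  shows "area_form n v (corner \<kappa> (Suc (Suc k))) = 0"
  by (rule area.orthogonal_span[OF _ assms(1)]) (use assms(2) corner_orthogonal in auto)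

lemma sum_turns: "(\<Sum>k = 1..i. \<kappa> k / (2 * pi)) = turns i"
  by (simp add: turns_def angle_def sum_divide_distrib)

lemma turns_1:
  shows "\<lfloor>turns (Suc 0)\<rfloor> = 0" "turns (Suc 0) \<notin> \<int>"
proof -
  have "0 < turns (Suc 0)" "turns (Suc 0) < 1"
    using turns_Suc[of 0] n by (auto simp: turns_0)
  then show "\<lfloor>turns (Suc 0)\<rfloor> = 0" "turns (Suc 0) \<notin> \<int>"
    by (auto simp: floor_eq_iff elim!: Ints_cases)
qed

text \<open>A full turn at \<open>Suc (Suc l)\<close> makes \<open>fan (Suc l)\<close> isotropic,
  yet it still pairs nontrivially with the next corner. Both vectors are orthogonal to
  \<open>flag l\<close>, so two dimensions are added at once.\<close>

lemma flag_Suc_hyperbolic: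
  assumes l: "Suc (Suc l) < n" and int: "turns (Suc (Suc l)) \<in> \<int>"
    and W: "diagonal_counts (flag l) (area_form n) p q"
  shows "diagonal_counts (flag (Suc (Suc l))) (area_form n) (Suc p) (Suc q)"
proof -
  \<comment> \<open>Consecutive values differ by less than 1 and cannot both be integers.\<close>
  have "turns (Suc l) \<notin> \<int>"
  proof
    assume "turns (Suc l) \<in> \<int>"
    then obtain a b :: int where ab: "turns (Suc l) = of_int a" "turns (Suc (Suc l)) = of_int b"
      using int by (auto elim!: Ints_cases)
    then have "real_of_int a < real_of_int b" "real_of_int b < real_of_int (a + 1)"
      using turns_Suc[of "Suc l"] l by auto
    then show False
      by (simp only: of_int_less_iff)
  qed
  then have one: "cis (angle (Suc l)) \<noteq> 1" and zero: "cis (angle (Suc (Suc l))) = 1"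
    using int by (simp_all add: cis_angle_eq_1_iff)
  have isotropic: "area_form n (fan (Suc l)) (fan (Suc l)) = 0"
  proof -
    obtain b :: int where "turns (Suc (Suc l)) = of_int b"
      using int by (auto elim: Ints_cases)
    then show ?thesis
      using l by (simp add: fan_fan)
  qed
  have "apex (\<kappa> (Suc (Suc l))) \<noteq> 0"
    using cis_\<kappa>[of "Suc (Suc l)"] l by (simp add: apex_def)
  then have pairing: "area_form n (fan (Suc l)) (corner \<kappa> (Suc (Suc l))) \<noteq> 0"
    using one l by (simp add: fan_corner_above)
  have "diagonal_counts (cvec.span (insert (corner \<kappa> (Suc (Suc l))) (insert (fan (Suc l)) (flag l))))
      (area_form n) (Suc p) (Suc q)"
    using l by (intro area.diagonal_counts_hyperbolic W isotropic pairing
        flag_orthogonal_fan flag_orthogonal_corner) auto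
  moreover have "flag (Suc (Suc l)) =
      cvec.span (insert (corner \<kappa> (Suc (Suc l))) (insert (fan (Suc l)) (flag l)))"
    unfolding flag_Suc[of "Suc l"] flag_Suc_fan[OF \<open>turns (Suc l) \<notin> \<int>\<close>]
    by (rule span_insert_span)
  ultimately show ?thesis
    by (simp only:)
qed

text \<open>Neither count grows if \<open>turns (Suc (Suc l))\<close> is an integer: the new fan is
  then null.\<close>

lemma flag_Suc_definite:
  assumes l: "Suc l < n" and int: "turns (Suc l) \<notin> \<int>"
    and W: "diagonal_counts (flag l) (area_form n) p q"
  shows "diagonal_counts (flag (Suc l)) (area_form n)
    (if sin (pi * turns (Suc l)) * sin (pi * turns (Suc (Suc l))) < 0 then Suc p else p)
    (if sin (pi * turns (Suc l)) * sin (pi * turns (Suc (Suc l))) > 0 then Suc q else q)"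
proof -
  have "base (fan (Suc l)) (Suc l) \<noteq> 0"
    using int cis_angle_eq_1_iff by (auto simp: base_fan)
  then have notin: "fan (Suc l) \<notin> flag l"
    using base_flag_eq_0 by blast
  have "sin (\<kappa> (Suc (Suc l)) / 2) > 0"
    using \<kappa>[of "Suc (Suc l)"] l by (intro sin_gt_zero) auto
  then have "Re (area_form n (fan (Suc l)) (fan (Suc l))) > 0 \<longleftrightarrow>
      sin (pi * turns (Suc l)) * sin (pi * turns (Suc (Suc l))) < 0"
    and "Re (area_form n (fan (Suc l)) (fan (Suc l))) < 0 \<longleftrightarrow>
      sin (pi * turns (Suc l)) * sin (pi * turns (Suc (Suc l))) > 0"
    using l by (simp_all add: fan_fan divide_less_0_iff zero_less_divide_iff)
  moreover note area.diagonal_counts_insert[OF W notin flag_orthogonal_fan[OF _ l]]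
  ultimately show ?thesis
    unfolding flag_Suc_fan[OF int] by (simp only:)
qed

text \<open>The index is shifted since the norm of \<open>fan k\<close> involves
  \<open>turns (Suc k)\<close>. At an integer value \<open>flag k\<close> has one null direction,
  hence the correction in \<open>p\<close>. Strong induction allows the hyperbolic case to go back
  two steps.\<close>

lemma flag_diagonal_counts:
  assumes "k < n"
  shows "\<exists>p q. diagonal_counts (flag k) (area_form n) p q \<and>
    int p = \<lfloor>turns (Suc k)\<rfloor> - of_bool (turns (Suc k) \<in> \<int>) \<and> int q = int k - \<lfloor>turns (Suc k)\<rfloor>"
  using assms
proof (induction k rule: less_induct)
  case (less k)
  show ?case
  proof (cases k)
    case 0
    have "diagonal_counts (flag 0) (area_form n) 0 0"
      using area.diagonal_counts_zero by simp
    then show ?thesis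
      using turns_1 0 by (intro exI[of _ 0]) simp
  next
    case (Suc m)
    have m: "Suc m < n"
      using less.prems Suc by simp
    show ?thesis
    proof (cases "turns (Suc m) \<in> \<int>")
      case False
      obtain p q where W: "diagonal_counts (flag m) (area_form n) p q"
        and pq: "int p = \<lfloor>turns (Suc m)\<rfloor>" "int q = int m - \<lfloor>turns (Suc m)\<rfloor>"
        using less.IH[of m] Suc m False by auto
      note W' = flag_Suc_definite[OF m False W]
      from turns_Suc[OF m] show ?thesis
      proof (cases rule: floor_step)
        case same
        then have "sin (pi * turns (Suc m)) * sin (pi * turns (Suc (Suc m))) > 0"
          using sin_pi_mult_pos False by simp
        then show ?thesis
          using W' pq same Suc by (intro exI[of _ p] exI[of _ "Suc q"]) simp
      next
        case jump
        show ?thesis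
        proof (cases "turns (Suc (Suc m)) \<in> \<int>")
          case True
          \<comment> \<open>The new fan is null: the rise of the floor is offset by the correction
            in \<open>p\<close> and by the larger dimension in \<open>q\<close>.\<close>
          then have "sin (pi * turns (Suc (Suc m))) = 0"
            by (auto elim!: Ints_cases)
          then show ?thesis
            using W' pq jump Suc True by (intro exI[of _ p] exI[of _ q]) simp
        next
          case nonint: False
          then have "sin (pi * turns (Suc m)) * sin (pi * turns (Suc (Suc m))) < 0"
            using sin_pi_mult_neg False jump by simp
          then show ?thesis
            using W' pq jump Suc nonint by (intro exI[of _ "Suc p"] exI[of _ q]) simp
        qed
      qed
    next
      case True
      \<comment> \<open>The first angle is less than a full turn, so \<open>m\<close> is not
        0.\<close>
      then obtain l where l: "m = Suc l"
        using turns_1 by (cases m) auto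
      obtain b :: int where b: "turns (Suc m) = of_int b"
        using True by (auto elim: Ints_cases)
      have "turns (Suc l) < b" "b < turns (Suc l) + 1" "b < turns (Suc k)" "turns (Suc k) < b + 1"
        using turns_Suc[of "Suc l"] turns_Suc[of "Suc m"] m l b Suc by simp_all
      \<comment> \<open>Both neighbours of the integer value are non-integers, so the counts for
        \<open>flag l\<close> and \<open>flag k\<close> carry no correction.\<close>
      then have fl: "\<lfloor>turns (Suc l)\<rfloor> = b - 1" "turns (Suc l) \<notin> \<int>"
        "\<lfloor>turns (Suc k)\<rfloor> = b" "turns (Suc k) \<notin> \<int>"
        by (auto simp: floor_eq_iff elim!: Ints_cases)
      obtain p q where "diagonal_counts (flag l) (area_form n) p q"
        and pq: "int p = b - 1" "int q = int l - (b - 1)"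
        using less.IH[of l] Suc l m fl by auto
      then have "diagonal_counts (flag k) (area_form n) (Suc p) (Suc q)"
        using flag_Suc_hyperbolic[of l p q] True m l Suc by simp
      then show ?thesis
        using pq fl Suc l by (intro exI[of _ "Suc p"] exI[of _ "Suc q"]) simp
    qed
  qed
qed

section \<open>Closed formulas for the invariants\<close>

lemma eps_kappa_turns: "eps_kappa n \<kappa> = of_bool (turns n \<in> \<int>)"
proof -
  have "(\<exists>m::int. angle n = 2 * pi * of_int m) \<longleftrightarrow> turns n \<in> \<int>"
    by (auto simp: turns_def field_simps elim!: Ints_cases)
  then show ?thesis
    unfolding eps_kappa_def angle_def by simp
qed

text \<open>The floor starts at 0 and rises by 0 or 1 in each of the \<open>m - 1\<close> steps; the
  steps counted are those without a rise.\<close>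

lemma card_same_floor:
  assumes "1 \<le> m" "m \<le> n"
  shows "int (card {i \<in> {1..<m}. \<lfloor>turns (i + 1)\<rfloor> = \<lfloor>turns i\<rfloor>}) = int m - 1 - \<lfloor>turns m\<rfloor>"
  using assms
proof (induction m rule: dec_induct)
  case base
  then show ?case
    using turns_1 by simp
next
  case (step m)
  define A where "A = {i \<in> {1..<m}. \<lfloor>turns (i + 1)\<rfloor> = \<lfloor>turns i\<rfloor>}"
  have A: "finite A" "m \<notin> A" "int (card A) = int m - 1 - \<lfloor>turns m\<rfloor>"
    using step.IH step.prems by (simp_all add: A_def)
  have Suc: "{i \<in> {1..<Suc m}. \<lfloor>turns (i + 1)\<rfloor> = \<lfloor>turns i\<rfloor>} =
      (if \<lfloor>turns (Suc m)\<rfloor> = \<lfloor>turns m\<rfloor> then insert m A else A)"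
    using step by (auto simp: A_def less_Suc_eq)
  have "\<lfloor>turns (Suc m)\<rfloor> = \<lfloor>turns m\<rfloor> \<or> \<lfloor>turns (Suc m)\<rfloor> = \<lfloor>turns m\<rfloor> + 1"
    using turns_Suc[of m] step.prems by linarith
  then show ?case
    unfolding Suc using A by auto
qed

lemma q_kappa_turns: "q_kappa n \<kappa> = int n - 1 - \<lfloor>turns n\<rfloor>"
  unfolding q_kappa_def sum_turns using card_same_floor n by simp

lemma p_kappa_turns: "p_kappa n \<kappa> = \<lfloor>turns n\<rfloor> - eps_kappa n \<kappa>"
  by (simp add: p_kappa_def q_kappa_turns)

text \<open>The last flag, \<open>flag (n - 1)\<close>, is the whole space, and its null correction
  is \<open>eps_kappa\<close>.\<close>

lemma signature: "has_signature (polygon_space n \<kappa>) (area_form n) (p_kappa n \<kappa>, q_kappa n \<kappa>)"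
proof -
  have n1: "Suc (n - 1) = n" "int (n - 1) = int n - 1"
    using n by auto
  obtain p q where "diagonal_counts (flag (n - 1)) (area_form n) p q"
    and "int p = p_kappa n \<kappa>" "int q = q_kappa n \<kappa>"
    using flag_diagonal_counts[of "n - 1"] n
    unfolding n1 p_kappa_turns q_kappa_turns eps_kappa_turns by auto
  moreover have "flag (n - 1) = polygon_space n \<kappa>"
    using span_corner n1 by (metis atLeastLessThanSuc_atLeastAtMost)
  ultimately show ?thesis
    using area.has_signature_if_diagonal_counts[of _ n p q] by simp
qed

end

theorem theorem3:
  fixes n :: nat and \<kappa> :: "nat \<Rightarrow> real"
  assumes "n > 1"
    and "\<And>i. i \<in> {1..n} \<Longrightarrow> 0 < \<kappa> i \<and> \<kappa> i < 2 * pi"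
  shows "has_signature (polygon_space n \<kappa>) (area_form n) (p_kappa n \<kappa>, q_kappa n \<kappa>) \<and>
         q_kappa n \<kappa> = int n - 1 - \<lfloor>\<Sum>k = 1..n. \<kappa> k / (2 * pi)\<rfloor> \<and>
         p_kappa n \<kappa> = \<lfloor>\<Sum>k = 1..n. \<kappa> k / (2 * pi)\<rfloor> - eps_kappa n \<kappa>"
proof -
  interpret polygon n \<kappa>
    using assms by unfold_locales auto
  show ?thesis
    unfolding sum_turns using signature q_kappa_turns p_kappa_turns by blast
qed

end
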